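(* Let $r\geq 2$ and let $A \in \mathbb{R}^{r \times r}$ be a $TP_{r-1}$ matrix. Then for every $q\in\mathbb{R}^r$ with $q<0$, the set $\mathrm{SOL}(A,q)$ does not simultaneously contain two vectors which have disjoint supports and at least one of which has two consecutive positive coordinates.
   Context: A real matrix is $TP_k$ (totally positive of order $k$) if all its minors of order at most $k$ are positive. $q<0$ means every coordinate of $q$ is negative. For $A\in\mathbb{R}^{r\times r}$ and $q\in\mathbb{R}^r$, $\mathrm{SOL}(A,q)$ is the set of solutions of the Linear Complementarity Problem $\mathrm{LCP}(A,q)$, i.e. the set of $x\in\mathbb{R}^r$ with $x\ge 0$, $y=Ax+q\ge 0$ (coordinatewise) and $x^Ty=0$. The support of a vector is the set of indices of its nonzero coordinates. *)

theory Defs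
  imports "Jordan_Normal_Form.DL_Submatrix" "Jordan_Normal_Form.Determinant"
begin

definition totally_positive_order :: "nat \<Rightarrow> real mat \<Rightarrow> bool" where
  "totally_positive_order k A \<longleftrightarrow>
     (\<forall>I J. I \<subseteq> {..<dim_row A} \<and> J \<subseteq> {..<dim_col A} \<and> card I = card J \<and>
            1 \<le> card I \<and> card I \<le> k \<longrightarrow> det (submatrix A I J) > 0)"

(* The library's strict order on vectors only means "u \<le> v and u \<noteq> v", so a
   coordinatewise strict inequality needs its own predicate. *)
definition negative_vec :: "real vec \<Rightarrow> bool" where
  "negative_vec q \<longleftrightarrow> (\<forall>i<dim_vec q. q $ i < 0)"

(* The order \<le> on vectors is coordinatewise and includes equality of dimensions. *)
definition SOL :: "real mat \<Rightarrow> real vec \<Rightarrow> real vec set" where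
  "SOL A q = {x \<in> carrier_vec (dim_col A).
      0\<^sub>v (dim_vec x) \<le> x \<and>
      0\<^sub>v (dim_vec q) \<le> A *\<^sub>v x + q \<and>
      x \<bullet> (A *\<^sub>v x + q) = 0}"

definition support_vec :: "real vec \<Rightarrow> nat set" where
  "support_vec x = {i. i < dim_vec x \<and> x $ i \<noteq> 0}"

definition two_consecutive_positive :: "real vec \<Rightarrow> bool" where
  "two_consecutive_positive x \<longleftrightarrow>
     (\<exists>i. Suc i < dim_vec x \<and> x $ i > 0 \<and> x $ Suc i > 0)"

end

theory Submission
  imports Defs
begin

text \<open>For solutions \<open>x\<close>, \<open>z\<close> of the complementarity problem, complementarity gives
  \<open>u i * (A u) i \<le> 0\<close> for \<open>u = x - z\<close> and all \<open>i\<close>. Two consecutive entries of \<open>u\<close> of equal sign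
  mean that the nonzero entries of \<open>u\<close> form \<open>n \<le> r - 1\<close> maximal blocks of constant sign, the
  signs alternating from block to block. Summing the columns of \<open>A\<close> over each block with weights
  \<open>\<bar>u j\<bar>\<close> and keeping one row per block yields an \<open>n \<times> n\<close> matrix \<open>B\<close> with positive minors, by
  multilinearity of the determinant. Applied to an alternating sign vector \<open>d\<close>, \<open>B\<close> weakly reverses
  all signs; but Cramer's rule expresses \<open>det B * d\<^sub>0\<close> as a sum in which every term then has
  the sign of \<open>- d\<^sub>0\<close>.\<close>

section \<open>Positive minors and block sums of columns\<close>

text \<open>\<open>submatrix\<close> enumerates its index sets by \<open>pick\<close>; this identity
  lets minors be indexed by increasing maps instead of sets.\<close>

lemma pick_image:
  assumes "strict_mono_on {..<n} f" and "k < n"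
  shows "pick (f ` {..<n}) k = f k"
proof -
  have inj: "inj_on f {..<n}" by (rule strict_mono_on_imp_inj_on[OF assms(1)])
  have "{a \<in> f ` {..<n}. a < f k} = f ` {..<k}"
  proof (intro subset_antisym subsetI)
    fix a assume "a \<in> {a \<in> f ` {..<n}. a < f k}"
    then obtain i where i: "i < n" "a = f i" "f i < f k" by auto
    with assms have "i < k" by (simp add: strict_mono_on_less)
    with i show "a \<in> f ` {..<k}" by auto
  next
    fix a assume "a \<in> f ` {..<k}"
    then obtain i where i: "i < k" "a = f i" by auto
    with assms have "f i < f k" by (simp add: strict_mono_on_less)
    with i assms show "a \<in> {a \<in> f ` {..<n}. a < f k}" by auto
  qed
  moreover have "pick (f ` {..<n}) (card {a \<in> f ` {..<n}. a < f k}) = f k"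
    using assms(2) by (intro pick_card_in_set) auto
  moreover have "card (f ` {..<k}) = k"
    using inj assms(2) by (subst card_image) (auto intro: inj_on_subset)
  ultimately show ?thesis by (simp only:)
qed

lemma det_pos_strict_mono:
  assumes "totally_positive_order k A" and "n \<le> k"
    and f: "strict_mono_on {..<n} f" "f ` {..<n} \<subseteq> {..<dim_row A}"
    and g: "strict_mono_on {..<n} g" "g ` {..<n} \<subseteq> {..<dim_col A}"
  shows "det (mat n n (\<lambda>(s, t). A $$ (f s, g t))) > 0"
proof (cases "n = 0")
  \<comment> \<open>\<open>totally_positive_order\<close> speaks only of minors of size at least 1.
    The empty determinant is 1; it occurs later as the cofactor of a 1 by 1 matrix.\<close>
  case True
  then show ?thesis by (simp add: det_dim_zero)
next
  case False
  have card: "card (f ` {..<n}) = n" "card (g ` {..<n}) = n"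
    using f g by (simp_all add: card_image strict_mono_on_imp_inj_on)
  have "{i. i < dim_row A \<and> i \<in> f ` {..<n}} = f ` {..<n}"
    and "{i. i < dim_col A \<and> i \<in> g ` {..<n}} = g ` {..<n}"
    using f g by auto
  then have "submatrix A (f ` {..<n}) (g ` {..<n}) = mat n n (\<lambda>(s, t). A $$ (f s, g t))"
    unfolding submatrix_def by (auto simp: card pick_image[OF f(1)] pick_image[OF g(1)])
  moreover have "det (submatrix A (f ` {..<n}) (g ` {..<n})) > 0"
    using assms(1)[unfolded totally_positive_order_def, rule_format, of "f ` {..<n}" "g ` {..<n}"]
      f g card False assms(2) by simp
  ultimately show ?thesis by simp
qed

text \<open>Multilinearity in the columns: in the Leibniz formula, the product over \<open>t\<close>
  of sums over \<open>C t\<close> expands into a sum over functions \<open>g\<close> choosing one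
  column from each block.\<close>

lemma det_sum_columns:
  fixes a :: "nat \<Rightarrow> 'b \<Rightarrow> 'c::comm_ring_1"
  assumes "\<And>t. t < n \<Longrightarrow> finite (C t)"
  shows "det (mat n n (\<lambda>(s, t). \<Sum>j\<in>C t. c j * a s j)) =
    (\<Sum>g\<in>PiE {0..<n} C. (\<Prod>t = 0..<n. c (g t)) * det (mat n n (\<lambda>(s, t). a s (g t))))"
proof -
  let ?P = "{p. p permutes {0..<n}}"
  have det_mat: "det (mat n n (\<lambda>(s, t). h s t)) =
      (\<Sum>p\<in>?P. signof p * (\<Prod>t = 0..<n. h (p t) t))" for h :: "nat \<Rightarrow> nat \<Rightarrow> 'c"
  proof -
    have "mat n n (\<lambda>(s, t). h s t) \<in> carrier_mat n n" by simp
    then show ?thesis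
      by (subst det_col)
        (auto intro!: sum.cong prod.cong arg_cong2[of _ _ _ _ "(*)"]
          simp: permutes_in_image atLeast0LessThan)
  qed
  have "det (mat n n (\<lambda>(s, t). \<Sum>j\<in>C t. c j * a s j)) =
      (\<Sum>p\<in>?P. signof p * (\<Prod>t = 0..<n. \<Sum>j\<in>C t. c j * a (p t) j))"
    by (rule det_mat)
  also have "\<dots> = (\<Sum>p\<in>?P. \<Sum>g\<in>PiE {0..<n} C.
      signof p * ((\<Prod>t = 0..<n. c (g t)) * (\<Prod>t = 0..<n. a (p t) (g t))))"
    using assms by (subst prod_sum_PiE) (auto simp: sum_distrib_left prod.distrib)
  also have "\<dots> = (\<Sum>g\<in>PiE {0..<n} C. (\<Prod>t = 0..<n. c (g t)) *
      (\<Sum>p\<in>?P. signof p * (\<Prod>t = 0..<n. a (p t) (g t))))"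
    by (subst sum.swap) (auto simp: sum_distrib_left mult_ac)
  also have "\<dots> = (\<Sum>g\<in>PiE {0..<n} C. (\<Prod>t = 0..<n. c (g t)) *
      det (mat n n (\<lambda>(s, t). a s (g t))))"
    by (simp add: det_mat)
  finally show ?thesis .
qed

text \<open>\<open>det_sum_columns\<close> gives a sum of minors of \<open>A\<close> with positive
  weights: the order of the blocks makes every choice function increasing, and nonempty blocks
  ensure that there is a term.\<close>

lemma det_pos_column_blocks:
  fixes c :: "nat \<Rightarrow> real"
  assumes tp: "totally_positive_order k A" and n: "n \<le> k"
    and f: "strict_mono_on {..<n} f" "f ` {..<n} \<subseteq> {..<dim_row A}"
    and C: "\<And>t. t < n \<Longrightarrow> C t \<noteq> {}" "\<And>t. t < n \<Longrightarrow> C t \<subseteq> {..<dim_col A}"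
    and less: "\<And>s t i j. \<lbrakk>s < t; t < n; i \<in> C s; j \<in> C t\<rbrakk> \<Longrightarrow> i < j"
    and c: "\<And>t j. \<lbrakk>t < n; j \<in> C t\<rbrakk> \<Longrightarrow> c j > 0"
  shows "det (mat n n (\<lambda>(s, t). \<Sum>j\<in>C t. c j * A $$ (f s, j))) > 0"
proof -
  have fin: "finite (C t)" if "t < n" for t
    using C(2)[OF that] by (rule finite_subset) simp
  have "(\<Prod>t = 0..<n. c (g t)) * det (mat n n (\<lambda>(s, t). A $$ (f s, g t))) > 0"
    if "g \<in> PiE {0..<n} C" for g
  proof -
    have g: "g t \<in> C t" if "t < n" for t using \<open>g \<in> PiE {0..<n} C\<close> that by auto
    have "strict_mono_on {..<n} g"
    proof (rule strict_mono_onI)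
      fix s t assume "s \<in> {..<n}" "t \<in> {..<n}" "s < t"
      then show "g s < g t" using less[of s t "g s" "g t"] g[of s] g[of t] by simp
    qed
    moreover have "g ` {..<n} \<subseteq> {..<dim_col A}" using g C(2) by blast
    ultimately show ?thesis
      using det_pos_strict_mono[OF tp n f] c g by (auto intro!: mult_pos_pos prod_pos)
  qed
  moreover have "finite (PiE {0..<n} C)" using fin by (auto intro: finite_PiE)
  moreover have "PiE {0..<n} C \<noteq> {}" using C(1) by (auto simp: PiE_eq_empty_iff)
  ultimately show ?thesis
    by (simp add: det_sum_columns[OF fin] sum_pos)
qed

section \<open>Sign blocks\<close>

text \<open>Here \<open>b\<close> numbers the sign blocks and \<open>e\<close> is the sign of block
  0; zero entries belong to no block. The induction appends one entry at a time.\<close>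

lemma sign_blocks_exist:
  fixes u :: "nat \<Rightarrow> real"
  shows "\<exists>n b e. (e = 1 \<or> e = - 1) \<and>
    (\<forall>i<m. u i \<noteq> 0 \<longrightarrow> b i < n \<and> u i = e * (- 1) ^ b i * \<bar>u i\<bar>) \<and>
    (\<forall>j<m. \<forall>i\<le>j. u i \<noteq> 0 \<longrightarrow> u j \<noteq> 0 \<longrightarrow> b i \<le> b j) \<and>
    (\<forall>s<n. \<exists>i<m. u i \<noteq> 0 \<and> b i = (s :: nat))"
proof (induction m)
  case 0
  show ?case by (rule exI[of _ 0]) auto
next
  case (Suc m)
  then obtain n b e where e: "e = 1 \<or> e = - 1"
    and b: "\<forall>i<m. u i \<noteq> 0 \<longrightarrow> b i < n \<and> u i = e * (- 1) ^ b i * \<bar>u i\<bar>"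
    and mono: "\<forall>j<m. \<forall>i\<le>j. u i \<noteq> 0 \<longrightarrow> u j \<noteq> 0 \<longrightarrow> b i \<le> b j"
    and surj: "\<forall>s<n. \<exists>i<m. u i \<noteq> 0 \<and> b i = (s :: nat)"
    by (elim exE conjE)
  show ?case
  proof (cases "u m = 0")
    case True
    with e b mono surj show ?thesis
      by (intro exI[of _ n] exI[of _ b] exI[of _ e]) (metis less_Suc_eq)
  next
    case False
    \<comment> \<open>Entry \<open>m\<close> goes to block \<open>k\<close>: the last block if the
      signs agree, a new block \<open>n\<close> otherwise. If \<open>n = 0\<close>, all earlier
      entries vanish and the leading sign can still be chosen.\<close>
    obtain k e' where e': "e' = 1 \<or> e' = - 1" "n \<noteq> 0 \<Longrightarrow> e' = e"
      and k: "k \<le> n" "n \<le> Suc k" and um: "u m = e' * (- 1) ^ k * \<bar>u m\<bar>"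
    proof (cases n)
      case 0
      with False show ?thesis by (intro that[of "sgn (u m)" 0]) (auto simp: sgn_if)
    next
      case (Suc p)
      have "e * (- 1) ^ p = 1 \<or> e * (- 1) ^ p = - 1"
        using e by (cases "even p") auto
      then have "u m = e * (- 1) ^ p * \<bar>u m\<bar> \<or> u m = e * (- 1) ^ n * \<bar>u m\<bar>"
        by (auto simp: Suc abs_if)
      then show ?thesis
      proof
        assume "u m = e * (- 1) ^ p * \<bar>u m\<bar>"
        then show ?thesis using e Suc by (intro that[of e p]) simp_all
      next
        assume "u m = e * (- 1) ^ n * \<bar>u m\<bar>"
        then show ?thesis using e by (intro that[of e n]) simp_all
      qed
    qed
    let ?b = "b(m := k)"
    have old: "b i \<le> k" "u i = e' * (- 1) ^ b i * \<bar>u i\<bar>" if "i < m" "u i \<noteq> 0" for i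
    proof -
      have "b i < n" "u i = e * (- 1) ^ b i * \<bar>u i\<bar>" using b that by blast+
      then show "b i \<le> k" "u i = e' * (- 1) ^ b i * \<bar>u i\<bar>" using k e'(2) by auto
    qed
    have "\<forall>i<Suc m. u i \<noteq> 0 \<longrightarrow> ?b i < Suc k \<and> u i = e' * (- 1) ^ ?b i * \<bar>u i\<bar>"
    proof (intro allI impI)
      fix i assume "i < Suc m" "u i \<noteq> 0"
      then show "?b i < Suc k \<and> u i = e' * (- 1) ^ ?b i * \<bar>u i\<bar>"
        using old[of i] um by (cases "i = m") (auto simp: le_imp_less_Suc)
    qed
    moreover have "\<forall>j<Suc m. \<forall>i\<le>j. u i \<noteq> 0 \<longrightarrow> u j \<noteq> 0 \<longrightarrow> ?b i \<le> ?b j"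
    proof (intro allI impI)
      fix i j assume "j < Suc m" "i \<le> j" "u i \<noteq> 0" "u j \<noteq> 0"
      then show "?b i \<le> ?b j"
        using old(1)[of i] mono by (cases "j = m"; cases "i = m") auto
    qed
    moreover have "\<forall>s<Suc k. \<exists>i<Suc m. u i \<noteq> 0 \<and> ?b i = s"
    proof (intro allI impI)
      fix s assume s: "s < Suc k"
      show "\<exists>i<Suc m. u i \<noteq> 0 \<and> ?b i = s"
      proof (cases "s = k")
        case True
        with False show ?thesis by auto
      next
        case ne: False
        with s k have "s < n" by simp
        with surj obtain i where "i < m" "u i \<noteq> 0" "b i = s" by blast
        then show ?thesis by (intro exI[of _ i]) auto
      qed
    qed
    ultimately show ?thesis using e'(1) by blast
  qed
qed

section \<open>Excluding sign reversal\<close>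

text \<open>Cramer's rule without division: row 0 of \<open>adj_mat B * B\<close>, which is
  \<open>det B\<close> times the identity, is applied to \<open>d\<close>.\<close>

lemma cofactor_expansion_mult_vec:
  fixes B :: "'a::comm_ring_1 mat"
  assumes "B \<in> carrier_mat n n" and "0 < n"
  shows "det B * d 0 =
    (\<Sum>s<n. (- 1) ^ s * det (mat_delete B s 0) * (\<Sum>t<n. B $$ (s, t) * d t))"
proof -
  have col: "(\<Sum>s<n. cofactor B s 0 * B $$ (s, t)) = (if t = 0 then det B else 0)" if "t < n" for t
  proof -
    have "(\<Sum>s<n. cofactor B s 0 * B $$ (s, t)) = (adj_mat B * B) $$ (0, t)"
      using assms that
      by (auto simp: adj_mat_def scalar_prod_def atLeast0LessThan intro!: sum.cong)
    also have "\<dots> = (if t = 0 then det B else 0)"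
      using assms that by (simp add: adj_mat)
    finally show ?thesis .
  qed
  have "(\<Sum>s<n. cofactor B s 0 * (\<Sum>t<n. B $$ (s, t) * d t)) =
      (\<Sum>t<n. (\<Sum>s<n. cofactor B s 0 * B $$ (s, t)) * d t)"
    by (simp add: sum_distrib_left sum_distrib_right mult.assoc) (rule sum.swap)
  also have "\<dots> = (\<Sum>t<n. if t = 0 then det B * d 0 else 0)"
    by (rule sum.cong) (auto simp: col)
  also have "\<dots> = det B * d 0" using assms(2) by simp
  finally show ?thesis by (simp add: cofactor_def)
qed

text \<open>The two adjacent positive entries bound the number of sign blocks by
  \<open>r - 1\<close>, so that all minors involved have an order covered by
  \<open>tp\<close>.\<close>

lemma no_sign_reversal:
  fixes u :: "nat \<Rightarrow> real"
  assumes A: "A \<in> carrier_mat r r" and tp: "totally_positive_order (r - 1) A"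
    and i: "Suc i < r" "u i > 0" "u (Suc i) > 0"
    and rev: "\<And>l. l < r \<Longrightarrow> u l * (\<Sum>j<r. A $$ (l, j) * u j) \<le> 0"
  shows False
proof -
  obtain n b e where e: "e = 1 \<or> e = - (1 :: real)"
    and bs: "\<forall>i<r. u i \<noteq> 0 \<longrightarrow> b i < n \<and> u i = e * (- 1) ^ b i * \<bar>u i\<bar>"
    and m: "\<forall>j<r. \<forall>i\<le>j. u i \<noteq> 0 \<longrightarrow> u j \<noteq> 0 \<longrightarrow> b i \<le> b j"
    and surj: "\<forall>s<n. \<exists>i<r. u i \<noteq> 0 \<and> b i = (s :: nat)"
    using sign_blocks_exist[where u = u and m = r] by (elim exE conjE)
  have b: "b i < n" and sgn: "u i = e * (- 1) ^ b i * \<bar>u i\<bar>" if "i < r" "u i \<noteq> 0" for i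
    using bs that by blast+
  have mono: "b i \<le> b j" if "j < r" "i \<le> j" "u i \<noteq> 0" "u j \<noteq> 0" for i j
    using m that by blast
  have n: "0 < n" using b[of i] i by simp
  \<comment> \<open>The row representing a block lies in the support of \<open>u\<close>, so
    \<open>rev\<close> at \<open>f s\<close> restricts the sign of \<open>w s\<close>.\<close>
  obtain f where f: "\<And>s. s < n \<Longrightarrow> f s < r \<and> u (f s) \<noteq> 0 \<and> b (f s) = s"
    using surj by metis
  have f_less: "f s < f t" if "s < t" "t < n" for s t
    using mono[of "f s" "f t"] f[of s] f[of t] that by (cases "f t \<le> f s") auto
  define C where "C t = {j. j < r \<and> u j \<noteq> 0 \<and> b j = t}" for t
  define B where "B = mat n n (\<lambda>(s, t). \<Sum>j\<in>C t. \<bar>u j\<bar> * A $$ (f s, j))"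
  define d where "d t = e * (- 1) ^ t" for t :: nat
  define w where "w s = (\<Sum>j<r. A $$ (f s, j) * u j)" for s
  have C_less: "k < j" if "s < t" "k \<in> C s" "j \<in> C t" for s t k j
    using mono[of k j] that by (cases "j \<le> k") (auto simp: C_def)
  have C_ne: "C t \<noteq> {}" if "t < n" for t using f[OF that] by (auto simp: C_def)

  \<comment> \<open>Equal signs force equal parity, so distinct block numbers would leave a block
    strictly between them, whose representative would lie strictly between \<open>i\<close> and
    \<open>Suc i\<close>.\<close>
  have "b i = b (Suc i)"
  proof (rule ccontr)
    assume "b i \<noteq> b (Suc i)"
    moreover have "b i \<le> b (Suc i)" using mono[of "Suc i" i] i by simp
    moreover have "even (b i) = even (b (Suc i))"
      using sgn[of i] sgn[of "Suc i"] i e by (auto split: if_splits simp: minus_one_power_iff)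
    ultimately have *: "Suc (b i) < b (Suc i)"
      by (metis Suc_lessI even_Suc le_neq_implies_less)
    then have "Suc (b i) < n" using b[of "Suc i"] i by simp
    from f[OF this] have k: "f (Suc (b i)) < r" "u (f (Suc (b i))) \<noteq> 0"
      "b (f (Suc (b i))) = Suc (b i)" by auto
    have "\<not> f (Suc (b i)) \<le> i" using mono[of i "f (Suc (b i))"] k i by auto
    moreover have "\<not> Suc i \<le> f (Suc (b i))" using mono[of "f (Suc (b i))" "Suc i"] k i * by auto
    ultimately show False by simp
  qed
  \<comment> \<open>Every block still has a member after \<open>i\<close> is dropped, since
    \<open>Suc i\<close> lies in the same block.\<close>
  have "{..<n} \<subseteq> b ` ({..<r} - {i})"
  proof
    fix s assume "s \<in> {..<n}"
    then have "f s < r" "b (f s) = s" using f by auto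
    moreover have "Suc i \<in> {..<r} - {i}" using i by simp
    ultimately show "s \<in> b ` ({..<r} - {i})"
      using \<open>b i = b (Suc i)\<close> by (cases "f s = i") (auto intro: rev_image_eqI)
  qed
  then have "n \<le> card (b ` ({..<r} - {i}))"
    using card_mono[of "b ` ({..<r} - {i})" "{..<n}"] by simp
  also have "\<dots> \<le> card ({..<r} - {i})" by (rule card_image_le) simp
  finally have nr: "n \<le> r - 1" using i by simp

  have B: "B \<in> carrier_mat n n" by (simp add: B_def)
  have detB: "det B > 0"
    unfolding B_def
  proof (rule det_pos_column_blocks[OF tp nr])
    show "strict_mono_on {..<n} f" by (intro strict_mono_onI) (auto intro: f_less)
    show "f ` {..<n} \<subseteq> {..<dim_row A}" using A f by auto
    show "k < j" if "s < t" "t < n" "k \<in> C s" "j \<in> C t" for s t k j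
      using C_less that by blast
  qed (use A C_ne in \<open>auto simp: C_def\<close>)
  have minor: "det (mat_delete B s 0) > 0" if "s < n" for s
  proof -
    \<comment> \<open>\<open>h\<close> skips the row of block \<open>s\<close>, and deleting column
      0 shifts the blocks by one, so the minor has the same block form.\<close>
    define h where "h k = f (if k < s then k else Suc k)" for k
    have "mat_delete B s 0 =
        mat (n - 1) (n - 1) (\<lambda>(k, t). \<Sum>j\<in>C (Suc t). \<bar>u j\<bar> * A $$ (h k, j))"
      using that by (auto simp: mat_delete_def B_def h_def)
    also have "det \<dots> > 0"
    proof (rule det_pos_column_blocks[OF tp])
      show "strict_mono_on {..<n - 1} h"
        unfolding h_def by (intro strict_mono_onI) (auto intro!: f_less)
      show "h ` {..<n - 1} \<subseteq> {..<dim_row A}"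
        unfolding h_def using A f that by auto
      show "k < j" if "s < t" "t < n - 1" "k \<in> C (Suc s)" "j \<in> C (Suc t)" for s t k j
        using C_less[of "Suc s" "Suc t" k j] that by simp
    qed (use A nr C_ne in \<open>auto simp: C_def\<close>)
    finally show ?thesis .
  qed

  \<comment> \<open>On block \<open>t\<close> the sign \<open>d t\<close> restores
    \<open>u j\<close> from its absolute value; indices outside all blocks have
    \<open>u j = 0\<close>.\<close>
  have Bd: "(\<Sum>t<n. B $$ (s, t) * d t) = w s" if "s < n" for s
  proof -
    have "(\<Sum>t<n. B $$ (s, t) * d t) = (\<Sum>t<n. \<Sum>j\<in>C t. A $$ (f s, j) * u j)"
    proof (rule sum.cong[OF refl])
      fix t assume t: "t \<in> {..<n}"
      have eq: "\<bar>u j\<bar> * A $$ (f s, j) * d t = A $$ (f s, j) * u j" if "j \<in> C t" for j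
      proof -
        have "u j = d t * \<bar>u j\<bar>" using that sgn[of j] by (simp add: C_def d_def)
        then show ?thesis by (metis mult.assoc mult.commute)
      qed
      show "B $$ (s, t) * d t = (\<Sum>j\<in>C t. A $$ (f s, j) * u j)"
        using \<open>s < n\<close> t by (simp add: B_def sum_distrib_right) (simp only: eq cong: sum.cong)
    qed
    also have "\<dots> = (\<Sum>j\<in>(\<Union>t<n. C t). A $$ (f s, j) * u j)"
      by (rule sum.UNION_disjoint[symmetric]) (auto simp: C_def)
    also have "\<dots> = w s"
      unfolding w_def by (rule sum.mono_neutral_left) (use b in \<open>auto simp: C_def\<close>)
    finally show ?thesis .
  qed
  have dw: "d s * w s \<le> 0" if "s < n" for s
  proof -
    have "u (f s) * w s \<le> 0" using rev f[OF that] by (simp add: w_def)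
    moreover have "u (f s) = d s * \<bar>u (f s)\<bar>" using sgn[of "f s"] f[OF that] by (simp add: d_def)
    ultimately have "\<bar>u (f s)\<bar> * (d s * w s) \<le> 0" by (metis mult.assoc mult.commute)
    then show ?thesis using f[OF that] by (simp add: mult_le_0_iff)
  qed
  \<comment> \<open>Since \<open>d 0 = e\<close>, the factor \<open>e\<close> cancels on the left;
    on the right it combines with the cofactor sign \<open>(- 1) ^ s\<close> to
    \<open>d s\<close>.\<close>
  have "det B = e * (det B * d 0)" using e by (auto simp: d_def)
  also have "\<dots> = (\<Sum>s<n. det (mat_delete B s 0) * (d s * w s))"
    unfolding cofactor_expansion_mult_vec[OF B n]
    by (subst sum_distrib_left, rule sum.cong[OF refl]) (simp add: Bd, simp add: d_def mult_ac)
  also have "\<dots> \<le> 0"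
    by (rule sum_nonpos) (use minor dw in \<open>auto simp: mult_le_0_iff less_le\<close>)
  finally show False using detB by simp
qed

section \<open>Solutions of the complementarity problem\<close>

text \<open>A scalar product of nonnegative vectors vanishes only if each of its terms does.\<close>

lemma SOL_coordinates:
  assumes A: "A \<in> carrier_mat r r" and q: "q \<in> carrier_vec r" and x: "x \<in> SOL A q" and i: "i < r"
  shows "x $ i \<ge> 0" and "(A *\<^sub>v x + q) $ i \<ge> 0" and "x $ i * (A *\<^sub>v x + q) $ i = 0"
proof -
  let ?y = "A *\<^sub>v x + q"
  have xr: "x \<in> carrier_vec r" using x A by (simp add: SOL_def)
  have nn: "x $ j \<ge> 0 \<and> ?y $ j \<ge> 0" if "j < r" for j
    using x xr q A that by (auto simp: SOL_def less_eq_vec_def)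
  then show "x $ i \<ge> 0" "?y $ i \<ge> 0" using i by auto
  have "(\<Sum>j = 0..<r. x $ j * ?y $ j) = 0"
    using x q A by (simp add: SOL_def scalar_prod_def)
  then have "\<forall>j\<in>{0..<r}. x $ j * ?y $ j = 0"
    by (subst (asm) sum_nonneg_eq_0_iff) (use nn in auto)
  then show "x $ i * ?y $ i = 0" using i by simp
qed

text \<open>By disjointness \<open>z\<close> vanishes where \<open>x\<close> is positive, so the
  consecutive positive pair survives in \<open>x - z\<close>, to which
  \<open>no_sign_reversal\<close> applies.\<close>

lemma no_disjoint_solutions:
  assumes A: "A \<in> carrier_mat r r" and tp: "totally_positive_order (r - 1) A"
    and q: "q \<in> carrier_vec r" and x: "x \<in> SOL A q" and z: "z \<in> SOL A q"
    and disj: "support_vec x \<inter> support_vec z = {}" and two: "two_consecutive_positive x"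
  shows False
proof -
  have dim: "x \<in> carrier_vec r" "z \<in> carrier_vec r" using x z A by (simp_all add: SOL_def)
  obtain i where i: "Suc i < r" "x $ i > 0" "x $ Suc i > 0"
    using two dim by (auto simp: two_consecutive_positive_def)
  have z0: "z $ j = 0" if "j < r" "x $ j > 0" for j
    using disj dim that by (fastforce simp: support_vec_def)
  show False
  proof (rule no_sign_reversal[OF A tp, where u = "\<lambda>j. x $ j - z $ j"])
    show "Suc i < r" by (fact i)
    show "x $ i - z $ i > 0" "x $ Suc i - z $ Suc i > 0" using i z0 by auto
    fix l assume l: "l < r"
    let ?y = "A *\<^sub>v x + q" and ?w = "A *\<^sub>v z + q"
    \<comment> \<open>The vector \<open>q\<close> cancels in the difference. After expansion, the
      terms pairing a solution with its own slack vanish, and the subtracted cross terms are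
      nonnegative.\<close>
    have "(\<Sum>j<r. A $$ (l, j) * (x $ j - z $ j)) = ?y $ l - ?w $ l"
      using A q dim l
      by (simp add: scalar_prod_def atLeast0LessThan right_diff_distrib sum_subtractf)
    moreover have "(x $ l - z $ l) * (?y $ l - ?w $ l) =
        x $ l * ?y $ l + z $ l * ?w $ l - x $ l * ?w $ l - z $ l * ?y $ l"
      by (simp only: algebra_simps)
    moreover have "\<dots> \<le> 0"
    proof -
      note cx = SOL_coordinates[OF A q x l] and cz = SOL_coordinates[OF A q z l]
      have "0 \<le> x $ l * ?w $ l" "0 \<le> z $ l * ?y $ l"
        by (rule mult_nonneg_nonneg[OF cx(1) cz(2)], rule mult_nonneg_nonneg[OF cz(1) cx(2)])
      then show ?thesis unfolding cx(3) cz(3) by linarith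
    qed
    ultimately show "(x $ l - z $ l) * (\<Sum>j<r. A $$ (l, j) * (x $ j - z $ j)) \<le> 0"
      by simp
  qed
qed

theorem proposition5p7:
  fixes r :: nat and A :: "real mat"
  assumes "r \<ge> 2"
    and "A \<in> carrier_mat r r"
    and "totally_positive_order (r - 1) A"
  shows "\<forall>q \<in> carrier_vec r. negative_vec q \<longrightarrow>
    \<not> (\<exists>x \<in> SOL A q. \<exists>z \<in> SOL A q.
         support_vec x \<inter> support_vec z = {} \<and>
         (two_consecutive_positive x \<or> two_consecutive_positive z))"
  \<comment> \<open>If \<open>z\<close> has the positive pair, the roles of \<open>x\<close> and
    \<open>z\<close> are exchanged.\<close>
  using no_disjoint_solutions[OF assms(2,3)] by (metis Int_commute)

end
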